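(* Let $k,m\ge 1$ be integers, and let $\alpha_1,\dots,\alpha_k\in\mathbb{C}$ and $\beta_1,\dots,\beta_k\in\mathbb{C}$ satisfy $|\alpha_i|>1$, $\alpha_i+\beta_i\neq 0$ and $\beta_i=-1/\overline{\alpha_i}$ for $i=1,\dots,k$. Let $\tilde A^{(k)}\in\mathbb{C}^{km\times km}$ and $\tilde B^{(k)}\in\mathbb{C}^{km\times m}$ be the matrices built from these shifts as described in the context. Define $$\rho_0:=1,\qquad \rho_i:=\prod_{j=1}^i|\alpha_j|^2,\qquad p_i:=(|\alpha_i|^2-1)\,\rho_{i-1}\qquad (i=1,\dots,k).$$ Then the matrix $$\tilde P^{(k)}=\operatorname{diag}(p_1,\ldots,p_k)\otimes I_m$$ solves the Stein equation $$\tilde A^{(k)}\tilde P^{(k)}(\tilde A^{(k)})^*-\tilde P^{(k)}+\tilde B^{(k)}(\tilde B^{(k)})^*=0.$$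
   Context: Here $^*$ denotes conjugate transpose, $\otimes$ the Kronecker product, $I_m$ the $m\times m$ identity, and $\mathbf 1_j$ the $j\times 1$ vector of ones. Given shifts $\alpha_i,\beta_i$, define scalar-block matrices recursively by $a^{(1)}=\beta_1$, $b^{(1)}=\alpha_1+\beta_1$, and for $j\ge 2$ $$a^{(j)}=\begin{bmatrix} a^{(j-1)} & 0\\ (\alpha_j+\beta_j)\mathbf 1_{j-1}^\top & \beta_j\end{bmatrix}\in\mathbb{C}^{j\times j},\qquad b^{(j)}=\begin{bmatrix} b^{(j-1)}\\ \alpha_j+\beta_j\end{bmatrix}\in\mathbb{C}^{j}.$$ Then $\tilde A^{(k)}=a^{(k)}\otimes I_m$ and $\tilde B^{(k)}=b^{(k)}\otimes I_m$. Equivalently, $a^{(k)}$ is lower triangular with $(i,i)$ entry $\beta_i$ and $(i,\ell)$ entry $\alpha_i+\beta_i$ for $\ell<i$, and $b^{(k)}=(\alpha_1+\beta_1,\dots,\alpha_k+\beta_k)^\top$. *)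

theory Defs
  imports Complex_Main "Jordan_Normal_Form.Schur_Decomposition"
begin

definition kronecker :: "'a :: semiring_1 mat \<Rightarrow> 'a mat \<Rightarrow> 'a mat" (infixl \<open>\<otimes>\<^sub>K\<close> 70) where
  "A \<otimes>\<^sub>K B = mat (dim_row A * dim_row B) (dim_col A * dim_col B)
     (\<lambda>(i, j). A $$ (i div dim_row B, j div dim_col B) * B $$ (i mod dim_row B, j mod dim_col B))"

definition ones_col :: "nat \<Rightarrow> complex mat" where
  "ones_col j = mat j 1 (\<lambda>_. 1)"

text \<open>Shifts are functions on the naturals, of which only the values at \<open>1, \<dots>, k\<close> are used.
  The recursions start at size \<open>1\<close>; the equations for size \<open>0\<close> only make the functions total.\<close>

fun a_mat :: "(nat \<Rightarrow> complex) \<Rightarrow> (nat \<Rightarrow> complex) \<Rightarrow> nat \<Rightarrow> complex mat" where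
  "a_mat \<alpha> \<beta> 0 = 0\<^sub>m 0 0"
| "a_mat \<alpha> \<beta> (Suc 0) = mat 1 1 (\<lambda>_. \<beta> 1)"
| "a_mat \<alpha> \<beta> (Suc (Suc n)) = (let j = Suc (Suc n) in
     four_block_mat
       (a_mat \<alpha> \<beta> (Suc n))                               (0\<^sub>m (Suc n) 1)
       ((\<alpha> j + \<beta> j) \<cdot>\<^sub>m transpose_mat (ones_col (Suc n)))  (mat 1 1 (\<lambda>_. \<beta> j)))"

fun b_mat :: "(nat \<Rightarrow> complex) \<Rightarrow> (nat \<Rightarrow> complex) \<Rightarrow> nat \<Rightarrow> complex mat" where
  "b_mat \<alpha> \<beta> 0 = 0\<^sub>m 0 1"
| "b_mat \<alpha> \<beta> (Suc 0) = mat 1 1 (\<lambda>_. \<alpha> 1 + \<beta> 1)"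
| "b_mat \<alpha> \<beta> (Suc (Suc n)) = (let j = Suc (Suc n) in
     b_mat \<alpha> \<beta> (Suc n) @\<^sub>r mat 1 1 (\<lambda>_. \<alpha> j + \<beta> j))"

definition A_tilde :: "nat \<Rightarrow> (nat \<Rightarrow> complex) \<Rightarrow> (nat \<Rightarrow> complex) \<Rightarrow> nat \<Rightarrow> complex mat" where
  "A_tilde m \<alpha> \<beta> k = a_mat \<alpha> \<beta> k \<otimes>\<^sub>K 1\<^sub>m m"

definition B_tilde :: "nat \<Rightarrow> (nat \<Rightarrow> complex) \<Rightarrow> (nat \<Rightarrow> complex) \<Rightarrow> nat \<Rightarrow> complex mat" where
  "B_tilde m \<alpha> \<beta> k = b_mat \<alpha> \<beta> k \<otimes>\<^sub>K 1\<^sub>m m"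

definition rho :: "(nat \<Rightarrow> complex) \<Rightarrow> nat \<Rightarrow> real" where
  "rho \<alpha> i = (\<Prod>j = 1..i. (cmod (\<alpha> j))\<^sup>2)"

definition p_diag :: "(nat \<Rightarrow> complex) \<Rightarrow> nat \<Rightarrow> real" where
  "p_diag \<alpha> i = ((cmod (\<alpha> i))\<^sup>2 - 1) * rho \<alpha> (i - 1)"

text \<open>Matrix indices start at \<open>0\<close>, so the diagonal entry at position \<open>i\<close> is \<open>p\<close> at \<open>i + 1\<close>.\<close>

definition P_tilde :: "nat \<Rightarrow> (nat \<Rightarrow> complex) \<Rightarrow> nat \<Rightarrow> complex mat" where
  "P_tilde m \<alpha> k = mat_diag k (\<lambda>i. complex_of_real (p_diag \<alpha> (Suc i))) \<otimes>\<^sub>K 1\<^sub>m m"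

lemma kronecker_carrier [simp, intro]:
  "A \<in> carrier_mat r c \<Longrightarrow> B \<in> carrier_mat r' c' \<Longrightarrow> A \<otimes>\<^sub>K B \<in> carrier_mat (r * r') (c * c')"
  by (auto simp: kronecker_def)

lemma a_mat_carrier [simp]: "a_mat \<alpha> \<beta> k \<in> carrier_mat k k"
  by (induction \<alpha> \<beta> k rule: a_mat.induct) (auto simp: Let_def ones_col_def)

lemma b_mat_carrier [simp]: "b_mat \<alpha> \<beta> k \<in> carrier_mat k 1"
  by (induction \<alpha> \<beta> k rule: b_mat.induct) (auto simp: Let_def append_rows_def)

lemma A_tilde_carrier [simp]: "A_tilde m \<alpha> \<beta> k \<in> carrier_mat (k * m) (k * m)"
  unfolding A_tilde_def by (intro kronecker_carrier) auto

lemma B_tilde_carrier [simp]: "B_tilde m \<alpha> \<beta> k \<in> carrier_mat (k * m) m"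
  unfolding B_tilde_def using kronecker_carrier[OF b_mat_carrier one_carrier_mat] by simp

lemma P_tilde_carrier [simp]: "P_tilde m \<alpha> k \<in> carrier_mat (k * m) (k * m)"
  unfolding P_tilde_def by (intro kronecker_carrier) auto

lemma a_mat_entry:
  assumes "i < k" "l < k"
  shows "a_mat \<alpha> \<beta> k $$ (i, l) =
    (if l < i then \<alpha> (Suc i) + \<beta> (Suc i) else if l = i then \<beta> (Suc i) else 0)"
  using assms
proof (induction \<alpha> \<beta> k rule: a_mat.induct)
  case (3 \<alpha> \<beta> n)
  have d: "dim_row (a_mat \<alpha> \<beta> (Suc n)) = Suc n" "dim_col (a_mat \<alpha> \<beta> (Suc n)) = Suc n"
    using carrier_matD[OF a_mat_carrier[of \<alpha> \<beta> "Suc n"]] by auto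
  show ?case
    using 3 d by (auto simp: Let_def ones_col_def less_Suc_eq)
qed auto

lemma b_mat_entry:
  assumes "i < k"
  shows "b_mat \<alpha> \<beta> k $$ (i, 0) = \<alpha> (Suc i) + \<beta> (Suc i)"
  using assms
proof (induction \<alpha> \<beta> k rule: b_mat.induct)
  case (3 \<alpha> \<beta> n)
  have d: "dim_row (b_mat \<alpha> \<beta> (Suc n)) = Suc n" "dim_col (b_mat \<alpha> \<beta> (Suc n)) = 1"
    using carrier_matD[OF b_mat_carrier[of \<alpha> \<beta> "Suc n"]] by auto
  show ?case
    using 3 d by (auto simp: Let_def append_rows_def less_Suc_eq)
qed auto

end

theory Submission
  imports Defs
begin

text \<open>Tensoring with an identity is compatible with products, adjoints, sums and differences, so the
  left-hand side of the equation is \<open>(a p a\<^sup>* - p + b b\<^sup>*) \<otimes> I\<close>, and it suffices to solve the scalar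
  Stein equation, where \<open>p = diag(p\<^sub>1, \<dots>, p\<^sub>k)\<close>.

  Write \<open>g\<^sub>i = \<alpha>\<^sub>i + \<beta>\<^sub>i\<close>. The definition \<open>p\<^sub>i = \<rho>\<^sub>i - \<rho>\<^sub>i\<^sub>-\<^sub>1\<close> makes partial sums of \<open>p\<close> telescope to
  \<open>p\<^sub>1 + \<dots> + p\<^sub>j\<^sub>-\<^sub>1 = \<rho>\<^sub>j\<^sub>-\<^sub>1 - 1\<close> (lemma \<open>sum_p_diag\<close>). Row \<open>i\<close> of \<open>a\<close> is constantly \<open>g\<^sub>i\<close> left of the
  diagonal, so for \<open>j \<le> i\<close> the entry \<open>(i, j)\<close> of \<open>a p a\<^sup>*\<close> contains the product of \<open>g\<^sub>i\<close> and the conjugate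
  of \<open>g\<^sub>j\<close> with the factor \<open>\<rho>\<^sub>j\<^sub>-\<^sub>1 - 1\<close>; the term \<open>b b\<^sup>*\<close> removes the \<open>- 1\<close>. Up to sign, \<open>\<beta>\<^sub>j\<close>
  is the reflection of \<open>\<alpha>\<^sub>j\<close> in the unit circle, which gives \<open>\<alpha>\<^sub>j * cnj g\<^sub>j = |\<alpha>\<^sub>j|\<^sup>2 - 1\<close>; hence the
  remaining term with the factor \<open>\<rho>\<^sub>j\<^sub>-\<^sub>1\<close> cancels against the one from the diagonal of row \<open>j\<close> for \<open>j < i\<close> and adds
  up with it to \<open>p\<^sub>j\<close> for \<open>j = i\<close>. Entries above the diagonal follow since all terms are Hermitian.\<close>

section \<open>Kronecker products and adjoints\<close>

lemma mat_adjoint_carrier: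
  "A \<in> carrier_mat r c \<Longrightarrow> mat_adjoint A \<in> carrier_mat c r"
  by (auto simp: mat_adjoint_def)

lemma mat_adjoint_index:
  assumes "i < dim_col A" "j < dim_row A"
  shows "mat_adjoint A $$ (i, j) = conjugate (A $$ (j, i))"
  using assms by (simp add: mat_adjoint_def mat_of_rows_def)

lemma kronecker_index:
  assumes "A \<in> carrier_mat r c" "B \<in> carrier_mat r' c'" "i < r * r'" "j < c * c'"
  shows "(A \<otimes>\<^sub>K B) $$ (i, j) = A $$ (i div r', j div c') * B $$ (i mod r', j mod c')"
  using assms by (auto simp: kronecker_def)

lemma div_mod_less_mult:
  fixes i r m :: nat
  assumes "i < r * m"
  shows "i div m < r" "i mod m < m"
  using assms by (auto simp: less_mult_imp_div_less intro!: mod_less_divisor gr0I)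

lemma sum_lessThan_mult:
  fixes f :: "nat \<Rightarrow> nat \<Rightarrow> 'a :: comm_monoid_add"
  shows "(\<Sum>s<n * m. f (s div m) (s mod m)) = (\<Sum>q<n. \<Sum>t<m. f q t)"
proof -
  have "(\<Sum>s = q * m..<q * m + m. f (s div m) (s mod m)) = (\<Sum>t<m. f q t)" for q
    by (rule sum.reindex_bij_witness[of _ "\<lambda>t. q * m + t" "\<lambda>s. s - q * m"])
       (auto simp: div_mult_self3 le_iff_add)
  then show ?thesis
    by (simp flip: sum.nat_group[of _ m n])
qed

text \<open>The mixed-product rule: a column index of \<open>A \<otimes> B\<close> is a pair of column indices of the factors,
  so the inner sum factors into two.\<close>

lemma kronecker_mult:
  fixes A B C D :: "'a :: comm_semiring_1 mat"
  assumes A: "A \<in> carrier_mat r n" and B: "B \<in> carrier_mat r' n'"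
    and C: "C \<in> carrier_mat n c" and D: "D \<in> carrier_mat n' c'"
  shows "(A \<otimes>\<^sub>K B) * (C \<otimes>\<^sub>K D) = (A * C) \<otimes>\<^sub>K (B * D)"
proof (rule eq_matI)
  fix i j
  assume "i < dim_row ((A * C) \<otimes>\<^sub>K (B * D))" "j < dim_col ((A * C) \<otimes>\<^sub>K (B * D))"
  then have ij: "i < r * r'" "j < c * c'"
    using A B C D by (auto simp: kronecker_def)
  note b = div_mod_less_mult[OF ij(1)] div_mod_less_mult[OF ij(2)]
  have AB: "A \<otimes>\<^sub>K B \<in> carrier_mat (r * r') (n * n')"
    and CD: "C \<otimes>\<^sub>K D \<in> carrier_mat (n * n') (c * c')"
    using A B C D by auto
  have "((A \<otimes>\<^sub>K B) * (C \<otimes>\<^sub>K D)) $$ (i, j)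
      = (\<Sum>s<n * n'. (A \<otimes>\<^sub>K B) $$ (i, s) * (C \<otimes>\<^sub>K D) $$ (s, j))"
    using AB CD ij by (simp add: scalar_prod_def atLeast0LessThan)
  also have "\<dots> = (\<Sum>s<n * n'.
      (A $$ (i div r', s div n') * B $$ (i mod r', s mod n'))
        * (C $$ (s div n', j div c') * D $$ (s mod n', j mod c')))"
    using ij by (intro sum.cong refl) (simp add: kronecker_index[OF A B] kronecker_index[OF C D])
  also have "\<dots> = (\<Sum>q<n. \<Sum>t<n'.
      (A $$ (i div r', q) * B $$ (i mod r', t)) * (C $$ (q, j div c') * D $$ (t, j mod c')))"
    by (rule sum_lessThan_mult)
  also have "\<dots> = (\<Sum>q<n. A $$ (i div r', q) * C $$ (q, j div c'))
      * (\<Sum>t<n'. B $$ (i mod r', t) * D $$ (t, j mod c'))"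
    by (simp add: sum_product mult_ac)
  also have "\<dots> = (A * C) $$ (i div r', j div c') * (B * D) $$ (i mod r', j mod c')"
    using A B C D b by (simp add: scalar_prod_def atLeast0LessThan)
  also have "\<dots> = ((A * C) \<otimes>\<^sub>K (B * D)) $$ (i, j)"
    by (rule kronecker_index[symmetric, where r = r and c = c])
       (use A B C D ij in auto)
  finally show "((A \<otimes>\<^sub>K B) * (C \<otimes>\<^sub>K D)) $$ (i, j) = ((A * C) \<otimes>\<^sub>K (B * D)) $$ (i, j)" .
qed (use A B C D in \<open>auto simp: kronecker_def\<close>)

lemma mat_adjoint_kronecker:
  fixes A B :: "'a :: conjugatable_field mat"
  assumes A: "A \<in> carrier_mat r c" and B: "B \<in> carrier_mat r' c'"
  shows "mat_adjoint (A \<otimes>\<^sub>K B) = mat_adjoint A \<otimes>\<^sub>K mat_adjoint B"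
proof (rule eq_matI)
  note A' = mat_adjoint_carrier[OF A] and B' = mat_adjoint_carrier[OF B]
  have AB: "A \<otimes>\<^sub>K B \<in> carrier_mat (r * r') (c * c')"
    using A B by auto
  fix i j
  assume "i < dim_row (mat_adjoint A \<otimes>\<^sub>K mat_adjoint B)"
    "j < dim_col (mat_adjoint A \<otimes>\<^sub>K mat_adjoint B)"
  then have ij: "i < c * c'" "j < r * r'"
    using A' B' by (auto simp: kronecker_def)
  note b = div_mod_less_mult[OF ij(1)] div_mod_less_mult[OF ij(2)]
  have "mat_adjoint (A \<otimes>\<^sub>K B) $$ (i, j) = conjugate ((A \<otimes>\<^sub>K B) $$ (j, i))"
    using AB ij by (intro mat_adjoint_index) auto
  also have "\<dots> = conjugate (A $$ (j div r', i div c')) * conjugate (B $$ (j mod r', i mod c'))"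
    using ij by (simp add: kronecker_index[OF A B] conjugate_dist_mul)
  also have "\<dots> = (mat_adjoint A \<otimes>\<^sub>K mat_adjoint B) $$ (i, j)"
    using ij b A B by (simp add: kronecker_index[OF A' B'] mat_adjoint_index)
  finally show "mat_adjoint (A \<otimes>\<^sub>K B) $$ (i, j) = (mat_adjoint A \<otimes>\<^sub>K mat_adjoint B) $$ (i, j)" .
qed (use A B in \<open>auto simp: kronecker_def mat_adjoint_def\<close>)

lemma mat_adjoint_one: "mat_adjoint (1\<^sub>m m) = (1\<^sub>m m :: complex mat)"
proof (rule eq_matI)
  fix i j assume "i < dim_row (1\<^sub>m m :: complex mat)" "j < dim_col (1\<^sub>m m :: complex mat)"
  then show "mat_adjoint (1\<^sub>m m) $$ (i, j) = (1\<^sub>m m :: complex mat) $$ (i, j)"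
    by (subst mat_adjoint_index) auto
qed (auto simp: mat_adjoint_def)

lemma kronecker_add_left:
  assumes "A \<in> carrier_mat r c" "B \<in> carrier_mat r c"
  shows "(A + B) \<otimes>\<^sub>K C = A \<otimes>\<^sub>K C + B \<otimes>\<^sub>K C"
  using assms
  by (intro eq_matI) (auto simp: kronecker_def div_mod_less_mult distrib_right)

lemma kronecker_minus_left:
  fixes A B C :: "'a :: ring_1 mat"
  assumes "A \<in> carrier_mat r c" "B \<in> carrier_mat r c"
  shows "(A - B) \<otimes>\<^sub>K C = A \<otimes>\<^sub>K C - B \<otimes>\<^sub>K C"
  using assms
  by (intro eq_matI) (auto simp: kronecker_def div_mod_less_mult left_diff_distrib)

lemma kronecker_zero_left:
  "C \<in> carrier_mat r' c' \<Longrightarrow> 0\<^sub>m r c \<otimes>\<^sub>K C = 0\<^sub>m (r * r') (c * c')"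
  by (intro eq_matI) (auto simp: kronecker_def div_mod_less_mult)

text \<open>The Stein operator is built from operations that commute with \<open>\<otimes> I\<close>.\<close>

lemma stein_kronecker_one:
  fixes a p b :: "complex mat"
  assumes a: "a \<in> carrier_mat k k" and p: "p \<in> carrier_mat k k" and b: "b \<in> carrier_mat k n"
  shows "(a \<otimes>\<^sub>K 1\<^sub>m m) * (p \<otimes>\<^sub>K 1\<^sub>m m) * mat_adjoint (a \<otimes>\<^sub>K 1\<^sub>m m) - p \<otimes>\<^sub>K 1\<^sub>m m
       + (b \<otimes>\<^sub>K 1\<^sub>m m) * mat_adjoint (b \<otimes>\<^sub>K 1\<^sub>m m)
     = (a * p * mat_adjoint a - p + b * mat_adjoint b) \<otimes>\<^sub>K 1\<^sub>m m"
proof -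
  note I = one_carrier_mat[of m]
  note a' = mat_adjoint_carrier[OF a] and b' = mat_adjoint_carrier[OF b]
  have ap: "a * p \<in> carrier_mat k k" and apa: "a * p * mat_adjoint a \<in> carrier_mat k k"
    and bb: "b * mat_adjoint b \<in> carrier_mat k k"
    using a p a' b b' by auto
  have "(a \<otimes>\<^sub>K 1\<^sub>m m) * (p \<otimes>\<^sub>K 1\<^sub>m m) * mat_adjoint (a \<otimes>\<^sub>K 1\<^sub>m m)
      = (a * p * mat_adjoint a) \<otimes>\<^sub>K 1\<^sub>m m"
    by (simp add: mat_adjoint_kronecker[OF a I] mat_adjoint_one
        kronecker_mult[OF a I p I] kronecker_mult[OF ap I a' I])
  moreover have "(b \<otimes>\<^sub>K 1\<^sub>m m) * mat_adjoint (b \<otimes>\<^sub>K 1\<^sub>m m) = (b * mat_adjoint b) \<otimes>\<^sub>K 1\<^sub>m m"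
    by (simp add: mat_adjoint_kronecker[OF b I] mat_adjoint_one kronecker_mult[OF b I b' I])
  moreover have "a * p * mat_adjoint a - p \<in> carrier_mat k k"
    using p by (rule minus_carrier_mat)
  ultimately show ?thesis
    using apa p bb by (simp add: kronecker_add_left kronecker_minus_left)
qed

section \<open>The scalar Stein equation\<close>

text \<open>The sum telescopes, because \<open>p\<close> is the sequence of increments of \<open>\<rho>\<close>.\<close>

lemma sum_p_diag: "(\<Sum>l<n. p_diag \<alpha> (Suc l)) = rho \<alpha> n - 1"
  by (induction n) (auto simp: p_diag_def rho_def algebra_simps)

text \<open>The factor \<open>\<rho> - 1\<close> from \<open>a p a\<^sup>*\<close> and the \<open>1\<close> from \<open>b b\<^sup>*\<close> combine to \<open>\<rho>\<close>; the second term is the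
  contribution of the diagonal entry of row \<open>j\<close>.\<close>

lemma stein_entry_lower:
  assumes "j \<le> i" "i < k"
  shows "(\<Sum>l<k. a_mat \<alpha> \<beta> k $$ (i, l) * of_real (p_diag \<alpha> (Suc l)) * cnj (a_mat \<alpha> \<beta> k $$ (j, l)))
       + b_mat \<alpha> \<beta> k $$ (i, 0) * cnj (b_mat \<alpha> \<beta> k $$ (j, 0))
     = (\<alpha> (Suc i) + \<beta> (Suc i)) * cnj (\<alpha> (Suc j) + \<beta> (Suc j)) * of_real (rho \<alpha> j)
       + a_mat \<alpha> \<beta> k $$ (i, j) * of_real (p_diag \<alpha> (Suc j)) * cnj (\<beta> (Suc j))"
proof -
  let ?t = "\<lambda>l. a_mat \<alpha> \<beta> k $$ (i, l) * of_real (p_diag \<alpha> (Suc l)) * cnj (a_mat \<alpha> \<beta> k $$ (j, l))"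
  let ?g = "\<lambda>i. \<alpha> (Suc i) + \<beta> (Suc i)"
  have "(\<Sum>l<k. ?t l) = (\<Sum>l<Suc j. ?t l)"
    using assms by (intro sum.mono_neutral_right) (auto simp: a_mat_entry)
  also have "\<dots> = (\<Sum>l<j. ?t l) + ?t j"
    by simp
  also have "(\<Sum>l<j. ?t l) = (\<Sum>l<j. ?g i * cnj (?g j) * of_real (p_diag \<alpha> (Suc l)))"
    using assms by (intro sum.cong refl) (simp add: a_mat_entry)
  also have "\<dots> = ?g i * cnj (?g j) * of_real (rho \<alpha> j - 1)"
    by (simp flip: sum_distrib_left sum_p_diag)
  also have "?t j = a_mat \<alpha> \<beta> k $$ (i, j) * of_real (p_diag \<alpha> (Suc j)) * cnj (\<beta> (Suc j))"
    using assms by (simp add: a_mat_entry)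
  finally show ?thesis
    using assms by (simp add: b_mat_entry algebra_simps)
qed

text \<open>Both cases reduce to \<open>\<alpha> * cnj (\<alpha> + \<beta>) = |\<alpha>|\<^sup>2 - 1\<close> and \<open>\<alpha> * cnj \<beta> = - 1\<close> at index \<open>j\<close>, after
  multiplying by \<open>\<alpha>\<close> (below the diagonal) or by \<open>|\<alpha>|\<^sup>2\<close> (on it).\<close>

lemma stein_entry_lower_reflected:
  assumes "j \<le> i" "i < k"
    and nz: "\<alpha> (Suc j) \<noteq> 0" and beta: "\<beta> (Suc j) = - 1 / cnj (\<alpha> (Suc j))"
  shows "(\<Sum>l<k. a_mat \<alpha> \<beta> k $$ (i, l) * of_real (p_diag \<alpha> (Suc l)) * cnj (a_mat \<alpha> \<beta> k $$ (j, l)))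
       + b_mat \<alpha> \<beta> k $$ (i, 0) * cnj (b_mat \<alpha> \<beta> k $$ (j, 0))
     = (if i = j then of_real (p_diag \<alpha> (Suc j)) else 0)"
proof -
  let ?x = "\<alpha> (Suc j)"
  have p: "of_real (p_diag \<alpha> (Suc j)) = (?x * cnj ?x - 1) * of_real (rho \<alpha> j)"
    using complex_norm_square[of ?x] by (simp add: p_diag_def)
  show ?thesis
  proof (cases "i = j")
    case True
    show ?thesis
      unfolding stein_entry_lower[OF assms(1,2)] p
      using assms True by (simp add: a_mat_entry beta field_simps)
  next
    case False
    show ?thesis
      unfolding stein_entry_lower[OF assms(1,2)] p
      using assms False by (simp add: a_mat_entry beta field_simps)
  qed
qed

lemma stein_scalar:
  fixes \<alpha> \<beta> :: "nat \<Rightarrow> complex"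
  assumes nz: "\<And>i. i \<in> {1..k} \<Longrightarrow> \<alpha> i \<noteq> 0"
    and beta: "\<And>i. i \<in> {1..k} \<Longrightarrow> \<beta> i = - 1 / cnj (\<alpha> i)"
  defines "p \<equiv> mat_diag k (\<lambda>i. complex_of_real (p_diag \<alpha> (Suc i)))"
  shows "a_mat \<alpha> \<beta> k * p * mat_adjoint (a_mat \<alpha> \<beta> k) - p
           + b_mat \<alpha> \<beta> k * mat_adjoint (b_mat \<alpha> \<beta> k) = 0\<^sub>m k k"
proof (rule eq_matI)
  define a b where "a = a_mat \<alpha> \<beta> k" and "b = b_mat \<alpha> \<beta> k"
  have a: "a \<in> carrier_mat k k" and b: "b \<in> carrier_mat k 1" and p: "p \<in> carrier_mat k k"
    unfolding a_def b_def p_def by (rule a_mat_carrier b_mat_carrier mat_diag_dim)+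
  note a' = mat_adjoint_carrier[OF a] and b' = mat_adjoint_carrier[OF b]
  define S where "S i j = (\<Sum>l<k. a $$ (i, l) * of_real (p_diag \<alpha> (Suc l)) * cnj (a $$ (j, l)))
       + b $$ (i, 0) * cnj (b $$ (j, 0))" for i j
  have lower: "S i j = (if i = j then of_real (p_diag \<alpha> (Suc j)) else 0)"
    if "j \<le> i" "i < k" for i j
    unfolding S_def a_def b_def
    using that by (intro stein_entry_lower_reflected nz beta) auto
  have herm: "S i j = cnj (S j i)" for i j
    by (simp add: S_def mult_ac)
  have S: "S i j = (if i = j then of_real (p_diag \<alpha> (Suc j)) else 0)" if "i < k" "j < k" for i j
  proof (cases "j \<le> i")
    case False
    then show ?thesis
      using that lower[of i j] by (simp add: herm[of i j] lower)
  qed (simp add: lower that)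
  fix i j
  assume "i < dim_row (0\<^sub>m k k :: complex mat)" "j < dim_col (0\<^sub>m k k :: complex mat)"
  then have ij: "i < k" "j < k"
    by auto
  have "(a * p * mat_adjoint a) $$ (i, j) + (b * mat_adjoint b) $$ (i, j) = S i j"
    using ij a b a' b'
    by (simp add: S_def p_def mat_diag_mult_right[OF a] scalar_prod_def mat_adjoint_index
        atLeast0LessThan)
  then have "(a * p * mat_adjoint a - p + b * mat_adjoint b) $$ (i, j) = S i j - p $$ (i, j)"
    using ij a b p a' b' by (simp add: algebra_simps)
  also have "\<dots> = 0"
    using ij by (simp add: S p_def mat_diag_def)
  finally show "(a_mat \<alpha> \<beta> k * p * mat_adjoint (a_mat \<alpha> \<beta> k) - p
           + b_mat \<alpha> \<beta> k * mat_adjoint (b_mat \<alpha> \<beta> k)) $$ (i, j) = 0\<^sub>m k k $$ (i, j)"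
    using ij by (simp add: a_def b_def)
qed (auto simp: mat_adjoint_def carrier_matD[OF b_mat_carrier])

theorem proposition2p1:
  fixes k m :: nat and \<alpha> \<beta> :: "nat \<Rightarrow> complex"
  assumes "k \<ge> 1" and "m \<ge> 1"
    and "\<And>i. i \<in> {1..k} \<Longrightarrow> cmod (\<alpha> i) > 1"
    and "\<And>i. i \<in> {1..k} \<Longrightarrow> \<alpha> i + \<beta> i \<noteq> 0"
    and "\<And>i. i \<in> {1..k} \<Longrightarrow> \<beta> i = - 1 / cnj (\<alpha> i)"
  shows "A_tilde m \<alpha> \<beta> k * P_tilde m \<alpha> k * mat_adjoint (A_tilde m \<alpha> \<beta> k) - P_tilde m \<alpha> k
           + B_tilde m \<alpha> \<beta> k * mat_adjoint (B_tilde m \<alpha> \<beta> k)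
         = 0\<^sub>m (k * m) (k * m)"
proof -
  have nz: "\<alpha> i \<noteq> 0" if "i \<in> {1..k}" for i
    using assms(3)[OF that] by auto
  show ?thesis
    unfolding A_tilde_def B_tilde_def P_tilde_def
      stein_kronecker_one[OF a_mat_carrier mat_diag_dim b_mat_carrier]
    by (subst stein_scalar[OF nz assms(5)]) (auto intro: kronecker_zero_left)
qed

end
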